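(* There is no stable base $\mathcal{B}$ where the law $A\vee B,\ \neg_\rho A\ \vdash_\rho\ B$ holds (i.e. is true for all algorithmic statements $A,B$) for all $\mathcal{B}$-libraries $\rho$. Likewise, there is no stable base $\mathcal{B}$ where the law $\neg_\rho A\vee B,\ A\ \vdash_\rho\ B$ holds for all $\mathcal{B}$-libraries $\rho$. In particular, no stable base contains either Rule $P_6$, the rule implementing the diagram $A\vee B,\ \neg_\rho A\,/\,B$, or Rule $P_7$, the rule implementing the diagram $\neg_\rho A\vee B,\ A\,/\,B$.
   Context: Framework. Algorithms are recursive algorithms in a fixed standard model. A datum is anything that can be input to an algorithm; data include natural numbers and algorithms, and every finite list of data is a datum. Every algorithm accepts exactly one input datum and either does not halt or halts with exactly one output datum. Every datum has a positive integer size, only finitely many data have a given size, and the size of a list is strictly greater than the sum of the sizes of its items. A process is a pair (algorithm, input). Every halting process has a positive integer runtime; if a process runs subprocesses in its execution, its runtime is strictly greater than the sum of the runtimes of the halting subprocesses. An algorithmic statement is a datum $[\alpha,u,v]$ with $\alpha$ an algorithm, asserting that $\alpha$ with input $u$ halts with output $v$; it is true if this is so and false otherwise, and it is directly false if $\alpha$ halts on $u$ with an output different from $v$. To say that an algorithmic statement holds is to say that it is true. $\mathcal{F}$ denotes the false statement $[\mathrm{identity},0,1]$, where $\mathrm{identity}$ outputs a copy of its input. Rules and libraries. An algorithmic sequence is an algorithm $\rho$ that halts on every positive integer $n$; its output is written $\rho_n$. A rule is an algorithm which, on every input $[H,\rho,m]$ with $H$ a finite list of algorithmic statements (hypothesis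 list), $\rho$ an algorithmic sequence (nominal library) and $m$ a positive integer (resource integer), halts and outputs a list of algorithmic statements (conclusion list) having $H$ as an initial sublist, and which is monotone: if $m'\ge m$ and every item of $H$ is an item of $H'$, then every item of the output on $[H,\rho,m]$ is an item of the output on $[H',\rho,m']$. A library is an algorithmic sequence $\rho$ such that every $\rho_n$ is a rule (not necessarily distinct); the $\rho_n$ are the rules contained in $\rho$. A rule is $\rho$-valid if for every list $H$ of true statements and every $m$, its output on $[H,\rho,m]$ consists only of true statements. A library $\rho$ is valid if all its rules are $\rho$-valid. Bases. A base is a set $\mathcal{B}$ of rules that is finite or is the set of terms of a library. A $\mathcal{B}$-library is a library containing all rules of $\mathcal{B}$. A $\mathcal{B}$-library $\rho$ is valid outside $\mathcal{B}$ if every rule in $\rho$ which is not in $\mathcal{B}$ is $\rho$-valid. A base $\mathcal{B}$ is stable if every $\mathcal{B}$-library that is valid outside $\mathcal{B}$ is valid. Deduction. Fix a recursive bijection $f:\mathbb{N}_+\to\mathbb{N}_+\times\mathbb{N}_+$. The algorithm $\mathrm{deduce}$, on input $[\Gamma,\rho,B]$ ($\Gamma$ a list of algorithmic statements, $\rho$ a library, $B$ an algorithmic statement), computes lists $H_0=\Gamma,H_1,H_2,\dots$, where for $i>0$ with $f(i)=(k,m)$ the list $H_i$ is the output of $\rho_k$ on $[H_{i-1},\rho,m]$; after computing each $H_i$ it checks whether $B$ is on $H_i$, outputs $1$ if so, and otherwise continues. The algorithmic statement $[\mathrm{deduce},[\Gamma,\rho,B],1]$ is denoted $\Gamma\vdash_\rho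 B$ (the notation is used for any datum $\rho$), and $A_1,\dots,A_n\vdash_\rho B$ means this with $\Gamma=[A_1,\dots,A_n]$. $A\Rightarrow_\rho B$ denotes $A\vdash_\rho B$, and $\neg_\rho A$ denotes $A\Rightarrow_\rho\mathcal{F}$. Disjunction. The algorithm $\mathrm{or}$ on input $[A,B]$ (two algorithmic statements) outputs $1$ if $A$ or $B$ is true, $0$ if both are directly false, and otherwise does not halt; $A\vee B$ denotes the statement $[\mathrm{or},[A,B],1]$. The negation $\neg_\rho$ binds more tightly than $\vee$. Rule diagrams. A rule implementing "$X_1,\dots,X_r\,/\,Y$" is the algorithm which on input $[H,\rho,m]$ outputs $H$ with $Y$ appended for every instance (letters ranging over algorithmic statements) whose premises $X_1,\dots,X_r$ are all on $H$; the $\rho$ in $\neg_\rho$ is the nominal library in the input. *)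

theory Defs
  imports Main "HOL-Library.Multiset" "HOL-Library.Nat_Bijection" "HOL-Library.Sublist"
begin

section \<open>Partial recursive functions\<close>

text \<open>
  Kleene's partial recursive functions, as terms with a big-step evaluation relation.
  Terms carry no arity: a term is read as a \<open>k\<close>-ary function by evaluating it on lists of
  length \<open>k\<close>.
\<close>

datatype recf =
    Zero
  | Succ
  | Proj nat
  | Comp recf "recf list"
  | PrimRec recf recf
  | Mu recf

inductive rec_eval :: "recf \<Rightarrow> nat list \<Rightarrow> nat \<Rightarrow> bool" where
  zero: "rec_eval Zero xs 0"
| succ: "rec_eval Succ (x # xs) (Suc x)"
| proj: "i < length xs \<Longrightarrow> rec_eval (Proj i) xs (xs ! i)"
| comp: "list_all2 (\<lambda>g y. rec_eval g xs y) gs ys \<Longrightarrow> rec_eval f ys z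
    \<Longrightarrow> rec_eval (Comp f gs) xs z"
| primrec_0: "rec_eval f xs y \<Longrightarrow> rec_eval (PrimRec f g) (0 # xs) y"
| primrec_Suc: "rec_eval (PrimRec f g) (n # xs) y \<Longrightarrow> rec_eval g (n # y # xs) z
    \<Longrightarrow> rec_eval (PrimRec f g) (Suc n # xs) z"
| mu: "rec_eval f (n # xs) 0 \<Longrightarrow> (\<forall>k<n. \<exists>y. rec_eval f (k # xs) (Suc y))
    \<Longrightarrow> rec_eval (Mu f) xs n"


section \<open>The model of computation\<close>

text \<open>
  The type \<open>'d\<close> is the type of data.  \<open>run M \<alpha> x\<close> is the output of the process \<open>(\<alpha>, x)\<close>,
  or \<open>None\<close> if it does not halt; it is meaningful only for \<open>\<alpha> \<in> algs M\<close>.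
  \<open>subprocs M \<alpha> x\<close> collects, with multiplicity, the processes run by a halting process
  \<open>(\<alpha>, x)\<close> in its execution.
\<close>

record 'd algorithm_model =
  algs :: "'d set"
  run :: "'d \<Rightarrow> 'd \<Rightarrow> 'd option"
  num :: "nat \<Rightarrow> 'd"
  lst :: "'d list \<Rightarrow> 'd"
  datum_size :: "'d \<Rightarrow> nat"
  runtime :: "'d \<Rightarrow> 'd \<Rightarrow> nat"
  subprocs :: "'d \<Rightarrow> 'd \<Rightarrow> ('d \<times> 'd) multiset"

definition halts :: "('d, 'm) algorithm_model_scheme \<Rightarrow> 'd \<Rightarrow> 'd \<Rightarrow> bool" where
  "halts M \<alpha> x \<longleftrightarrow> run M \<alpha> x \<noteq> None"

definition code_decidable :: "('d \<Rightarrow> nat) \<Rightarrow> 'd set \<Rightarrow> bool" where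
  "code_decidable code D \<longleftrightarrow>
     (\<exists>r. \<forall>x. rec_eval r [code x] (if x \<in> D then 1 else 0))"

text \<open>
  A Goedel numbering of the data for which algorithms are the recursive ones: numbers and
  lists are encoded and decoded recursively (lists of codes being packed into one number by
  \<open>list_encode\<close>), the kind of a datum is decidable, evaluation of algorithms is
  partial recursive uniformly in the algorithm, and conversely every partial
  recursive function on data is computed by an algorithm.
\<close>

definition effective_numbering ::
  "('d, 'm) algorithm_model_scheme \<Rightarrow> ('d \<Rightarrow> nat) \<Rightarrow> bool" where
  "effective_numbering M code \<longleftrightarrow>
     inj code \<and>
     (\<exists>r. \<forall>n. rec_eval r [n] (code (num M n))) \<and>
     (\<exists>r. \<forall>n. rec_eval r [code (num M n)] n) \<and>
     (\<exists>r. \<forall>ds. rec_eval r [list_encode (map code ds)] (code (lst M ds))) \<and>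
     (\<exists>r. \<forall>ds. rec_eval r [code (lst M ds)] (list_encode (map code ds))) \<and>
     code_decidable code (range (num M)) \<and>
     code_decidable code (range (lst M)) \<and>
     code_decidable code (algs M) \<and>
     (\<exists>r. \<forall>\<alpha>\<in>algs M. \<forall>x z.
        rec_eval r [code \<alpha>, code x] z \<longleftrightarrow> (\<exists>y. run M \<alpha> x = Some y \<and> z = code y)) \<and>
     (\<forall>g r. (\<forall>x z. rec_eval r [code x] z \<longleftrightarrow> (\<exists>y. g x = Some y \<and> z = code y)) \<longrightarrow>
        (\<exists>\<alpha>\<in>algs M. \<forall>x. run M \<alpha> x = g x))"

locale standard_model =
  fixes M :: "('d, 'm) algorithm_model_scheme"
  assumes num_inj: "inj (num M)"
    and lst_inj: "inj (lst M)"
    and size_pos: "datum_size M d > 0"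
    and size_finite: "finite {d. datum_size M d = n}"
    and size_lst: "(\<Sum>d\<leftarrow>ds. datum_size M d) < datum_size M (lst M ds)"
    and runtime_pos: "\<alpha> \<in> algs M \<Longrightarrow> halts M \<alpha> x \<Longrightarrow> runtime M \<alpha> x > 0"
    and subprocs_algs:
      "\<alpha> \<in> algs M \<Longrightarrow> halts M \<alpha> x \<Longrightarrow> (\<beta>, y) \<in># subprocs M \<alpha> x \<Longrightarrow> \<beta> \<in> algs M"
    and runtime_subprocs:
      "\<alpha> \<in> algs M \<Longrightarrow> halts M \<alpha> x \<Longrightarrow>
         (\<Sum>(\<beta>, y)\<in>#filter_mset (\<lambda>(\<beta>, y). halts M \<beta> y) (subprocs M \<alpha> x). runtime M \<beta> y)
           < runtime M \<alpha> x"
    and effective: "\<exists>code. effective_numbering M code"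


section \<open>Algorithmic statements\<close>

definition stmts :: "('d, 'm) algorithm_model_scheme \<Rightarrow> 'd set" where
  "stmts M = {lst M [\<alpha>, u, v] | \<alpha> u v. \<alpha> \<in> algs M}"

definition true_stmts :: "('d, 'm) algorithm_model_scheme \<Rightarrow> 'd set" where
  "true_stmts M = {lst M [\<alpha>, u, v] | \<alpha> u v. \<alpha> \<in> algs M \<and> run M \<alpha> u = Some v}"

definition directly_false :: "('d, 'm) algorithm_model_scheme \<Rightarrow> 'd set" where
  "directly_false M =
     {lst M [\<alpha>, u, v] | \<alpha> u v. \<alpha> \<in> algs M \<and> (\<exists>w. run M \<alpha> u = Some w \<and> w \<noteq> v)}"


section \<open>Rules, libraries and bases\<close>

definition alg_seqs :: "('d, 'm) algorithm_model_scheme \<Rightarrow> 'd set" where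
  "alg_seqs M = {\<rho> \<in> algs M. \<forall>n>0. halts M \<rho> (num M n)}"

definition seq_term :: "('d, 'm) algorithm_model_scheme \<Rightarrow> 'd \<Rightarrow> nat \<Rightarrow> 'd" where
  "seq_term M \<rho> n = the (run M \<rho> (num M n))"

definition seq_terms :: "('d, 'm) algorithm_model_scheme \<Rightarrow> 'd \<Rightarrow> 'd set" where
  "seq_terms M \<rho> = {seq_term M \<rho> n | n. n > 0}"

definition outputs ::
  "('d, 'm) algorithm_model_scheme \<Rightarrow> 'd \<Rightarrow> 'd list \<Rightarrow> 'd \<Rightarrow> nat \<Rightarrow> 'd list \<Rightarrow> bool" where
  "outputs M r H \<rho> m C \<longleftrightarrow> run M r (lst M [lst M H, \<rho>, num M m]) = Some (lst M C)"

definition is_rule :: "('d, 'm) algorithm_model_scheme \<Rightarrow> 'd \<Rightarrow> bool" where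
  "is_rule M r \<longleftrightarrow>
     r \<in> algs M \<and>
     (\<forall>H \<rho> m. set H \<subseteq> stmts M \<and> \<rho> \<in> alg_seqs M \<and> m > 0 \<longrightarrow>
        (\<exists>C. outputs M r H \<rho> m C \<and> set C \<subseteq> stmts M \<and> prefix H C)) \<and>
     (\<forall>H H' \<rho> m m' C C'.
        set H \<subseteq> stmts M \<and> set H' \<subseteq> stmts M \<and> \<rho> \<in> alg_seqs M \<and> m > 0 \<and>
        m \<le> m' \<and> set H \<subseteq> set H' \<and>
        outputs M r H \<rho> m C \<and> outputs M r H' \<rho> m' C' \<longrightarrow> set C \<subseteq> set C')"

definition is_library :: "('d, 'm) algorithm_model_scheme \<Rightarrow> 'd \<Rightarrow> bool" where
  "is_library M \<rho> \<longleftrightarrow> \<rho> \<in> alg_seqs M \<and> (\<forall>r\<in>seq_terms M \<rho>. is_rule M r)"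

definition valid_rule :: "('d, 'm) algorithm_model_scheme \<Rightarrow> 'd \<Rightarrow> 'd \<Rightarrow> bool" where
  "valid_rule M \<rho> r \<longleftrightarrow>
     (\<forall>H m C. set H \<subseteq> true_stmts M \<and> m > 0 \<and> outputs M r H \<rho> m C \<longrightarrow> set C \<subseteq> true_stmts M)"

definition valid_library :: "('d, 'm) algorithm_model_scheme \<Rightarrow> 'd \<Rightarrow> bool" where
  "valid_library M \<rho> \<longleftrightarrow> is_library M \<rho> \<and> (\<forall>r\<in>seq_terms M \<rho>. valid_rule M \<rho> r)"

definition is_base :: "('d, 'm) algorithm_model_scheme \<Rightarrow> 'd set \<Rightarrow> bool" where
  "is_base M \<B> \<longleftrightarrow>
     (\<forall>r\<in>\<B>. is_rule M r) \<and>
     (finite \<B> \<or> (\<exists>\<rho>. is_library M \<rho> \<and> \<B> = seq_terms M \<rho>))"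

definition base_library :: "('d, 'm) algorithm_model_scheme \<Rightarrow> 'd set \<Rightarrow> 'd \<Rightarrow> bool" where
  "base_library M \<B> \<rho> \<longleftrightarrow> is_library M \<rho> \<and> \<B> \<subseteq> seq_terms M \<rho>"

definition valid_outside :: "('d, 'm) algorithm_model_scheme \<Rightarrow> 'd set \<Rightarrow> 'd \<Rightarrow> bool" where
  "valid_outside M \<B> \<rho> \<longleftrightarrow> (\<forall>r\<in>seq_terms M \<rho> - \<B>. valid_rule M \<rho> r)"

definition stable_base :: "('d, 'm) algorithm_model_scheme \<Rightarrow> 'd set \<Rightarrow> bool" where
  "stable_base M \<B> \<longleftrightarrow>
     is_base M \<B> \<and>
     (\<forall>\<rho>. base_library M \<B> \<rho> \<and> valid_outside M \<B> \<rho> \<longrightarrow> valid_library M \<rho>)"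


section \<open>Deduction and disjunction\<close>

text \<open>
  The fixed recursive bijection \<open>enum_pairs\<close> is constrained only on the positive integers.
\<close>

record 'd logic_model = "'d algorithm_model" +
  enum_pairs :: "nat \<Rightarrow> nat \<times> nat"
  identity_alg :: 'd
  deduce_alg :: 'd
  or_alg :: 'd

definition falsum :: "'d logic_model \<Rightarrow> 'd" where
  "falsum M = lst M [identity_alg M, num M 0, num M 1]"

definition turnstile :: "'d logic_model \<Rightarrow> 'd list \<Rightarrow> 'd \<Rightarrow> 'd \<Rightarrow> 'd" where
  "turnstile M \<Gamma> \<rho> B = lst M [deduce_alg M, lst M [lst M \<Gamma>, \<rho>, B], num M 1]"

definition conditional :: "'d logic_model \<Rightarrow> 'd \<Rightarrow> 'd \<Rightarrow> 'd \<Rightarrow> 'd" where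
  "conditional M \<rho> A B = turnstile M [A] \<rho> B"

definition neg :: "'d logic_model \<Rightarrow> 'd \<Rightarrow> 'd \<Rightarrow> 'd" where
  "neg M \<rho> A = conditional M \<rho> A (falsum M)"

definition or_stmt :: "'d logic_model \<Rightarrow> 'd \<Rightarrow> 'd \<Rightarrow> 'd" where
  "or_stmt M A B = lst M [or_alg M, lst M [A, B], num M 1]"

text \<open>The lists \<open>H\<^sub>i\<close>; meaningful when \<open>\<rho>\<close> is a library and \<open>\<Gamma>\<close> consists of statements.\<close>

primrec deduction :: "'d logic_model \<Rightarrow> 'd list \<Rightarrow> 'd \<Rightarrow> nat \<Rightarrow> 'd list" where
  "deduction M \<Gamma> \<rho> 0 = \<Gamma>"
| "deduction M \<Gamma> \<rho> (Suc i) =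
     (case enum_pairs M (Suc i) of
        (k, m) \<Rightarrow> (THE C. outputs M (seq_term M \<rho> k) (deduction M \<Gamma> \<rho> i) \<rho> m C))"

text \<open>
  The algorithms \<open>deduce\<close> and \<open>or\<close> are any algorithms with the prescribed behaviour; what they
  do on inputs not of the prescribed form is left open.
\<close>

locale algorithmic_logic = standard_model M for M :: "'d logic_model" +
  assumes enum_bij: "bij_betw (enum_pairs M) {1..} ({1..} \<times> {1..})"
    and enum_recursive:
      "\<exists>r s. \<forall>i\<ge>1. rec_eval r [i] (fst (enum_pairs M i)) \<and> rec_eval s [i] (snd (enum_pairs M i))"
    and identity_alg: "identity_alg M \<in> algs M"
    and identity_run: "run M (identity_alg M) x = Some x"
    and deduce_alg: "deduce_alg M \<in> algs M"
    and deduce_run: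
      "set \<Gamma> \<subseteq> stmts M \<Longrightarrow> is_library M \<rho> \<Longrightarrow> B \<in> stmts M \<Longrightarrow>
         run M (deduce_alg M) (lst M [lst M \<Gamma>, \<rho>, B]) =
           (if \<exists>i. B \<in> set (deduction M \<Gamma> \<rho> i) then Some (num M 1) else None)"
    and or_alg: "or_alg M \<in> algs M"
    and or_run:
      "A \<in> stmts M \<Longrightarrow> B \<in> stmts M \<Longrightarrow>
         run M (or_alg M) (lst M [A, B]) =
           (if A \<in> true_stmts M \<or> B \<in> true_stmts M then Some (num M 1)
            else if A \<in> directly_false M \<and> B \<in> directly_false M then Some (num M 0)
            else None)"


section \<open>Rule diagrams\<close>

text \<open>
  A diagram assigns to each nominal library the set of its instances \<open>(premises, conclusion)\<close>.
  An implementing algorithm may append the conclusions in any order, with repetitions.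
\<close>

definition implements ::
  "'d logic_model \<Rightarrow> ('d \<Rightarrow> ('d list \<times> 'd) set) \<Rightarrow> 'd \<Rightarrow> bool" where
  "implements M \<D> r \<longleftrightarrow>
     r \<in> algs M \<and>
     (\<forall>H \<rho> m. set H \<subseteq> stmts M \<and> \<rho> \<in> alg_seqs M \<and> m > 0 \<longrightarrow>
        (\<exists>Ys. outputs M r H \<rho> m (H @ Ys) \<and>
              set Ys = {Y. \<exists>Xs. (Xs, Y) \<in> \<D> \<rho> \<and> set Xs \<subseteq> set H}))"

definition diagram_P6 :: "'d logic_model \<Rightarrow> 'd \<Rightarrow> ('d list \<times> 'd) set" where
  "diagram_P6 M \<rho> = {([or_stmt M A B, neg M \<rho> A], B) | A B. A \<in> stmts M \<and> B \<in> stmts M}"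

definition diagram_P7 :: "'d logic_model \<Rightarrow> 'd \<Rightarrow> ('d list \<times> 'd) set" where
  "diagram_P7 M \<rho> = {([or_stmt M (neg M \<rho> A) B, A], B) | A B. A \<in> stmts M \<and> B \<in> stmts M}"

end

theory Submission
  imports Defs
begin

text \<open>
  Let the sentence \<open>Q\<close> say \<open>\<not>\<^sub>\<rho> Q\<close>. Adding to a stable base the rule that infers from \<open>Q\<close> the
  statements \<open>Q \<or> F\<close> and \<open>\<not>\<^sub>\<rho> Q\<close> (respectively \<open>\<not>\<^sub>\<rho> Q \<or> F\<close> and \<open>Q\<close>), which are true if \<open>Q\<close> is,
  gives a valid library \<open>\<rho>\<close>, where \<open>F\<close> is the false statement \<open>falsum\<close>. The law with
  \<open>A = Q\<close> and \<open>B = F\<close> then yields \<open>Q \<turnstile>\<^sub>\<rho> F\<close>. This is what \<open>Q\<close> says, so \<open>Q\<close> is true and \<open>F\<close> is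
  derivable from a true statement in a valid library: Curry's paradox.
\<close>

section \<open>Recursive functions on numbers\<close>

text \<open>Needed because algorithms are matched to terms by an equivalence: a term producing the
  right value must also produce no other one.\<close>

lemma rec_eval_deterministic: "rec_eval f xs y \<Longrightarrow> rec_eval f xs z \<Longrightarrow> y = z"
proof (induction arbitrary: z rule: rec_eval.induct)
  case (comp xs gs ys f w)
  from comp.prems obtain ys' where ys': "list_all2 (\<lambda>g y. rec_eval g xs y) gs ys'" "rec_eval f ys' z"
    by cases auto
  have "ys = ys'"
  proof (rule nth_equalityI)
    show "length ys = length ys'"
      using comp.IH(1) ys'(1) by (simp add: list_all2_lengthD[symmetric])
    show "ys ! i = ys' ! i" if "i < length ys" for i
      using comp.IH(1) ys'(1) that by (auto simp: list_all2_conv_all_nth)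
  qed
  with comp.IH(2) ys'(2) show ?case by simp
next
  case (primrec_0 f xs y g)
  from primrec_0.prems show ?case by cases (auto intro: primrec_0.IH)
next
  case (primrec_Suc f g n xs y w)
  from primrec_Suc.prems obtain y' where "rec_eval (PrimRec f g) (n # xs) y'" "rec_eval g (n # y' # xs) z"
    by cases auto
  with primrec_Suc.IH show ?case by metis
next
  case (mu f n xs)
  from mu.prems obtain z: "rec_eval f (z # xs) 0" "\<forall>k<z. \<exists>y. rec_eval f (k # xs) (Suc y)"
    by cases auto
  \<comment> \<open>Two least zeros exclude each other: the smaller one would have value 0 and, by
    minimality of the larger, also a positive value.\<close>
  have "\<not> n < z" using mu.IH(1) z(2) by fastforce
  moreover have "\<not> z < n" using mu.IH(2) z(1) by fastforce
  ultimately show ?case by simp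
qed (auto elim: rec_eval.cases)

text \<open>Separates evaluation from arithmetic: the value is first left open and built up by the
  introduction rules, and only then compared with the intended one.\<close>

lemma rec_eval_eq: "rec_eval f xs y \<Longrightarrow> y = z \<Longrightarrow> rec_eval f xs z"
  by simp

lemma rec_eval_Comp1:
  "rec_eval g xs a \<Longrightarrow> rec_eval f [a] z \<Longrightarrow> rec_eval (Comp f [g]) xs z"
  by (rule rec_eval.comp[where ys = "[a]"]) auto

lemma rec_eval_Comp2:
  "rec_eval g xs a \<Longrightarrow> rec_eval h xs b \<Longrightarrow> rec_eval f [a, b] z \<Longrightarrow> rec_eval (Comp f [g, h]) xs z"
  by (rule rec_eval.comp[where ys = "[a, b]"]) auto

lemma rec_eval_Comp3:
  "rec_eval g xs a \<Longrightarrow> rec_eval h xs b \<Longrightarrow> rec_eval k xs c \<Longrightarrow> rec_eval f [a, b, c] z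
    \<Longrightarrow> rec_eval (Comp f [g, h, k]) xs z"
  by (rule rec_eval.comp[where ys = "[a, b, c]"]) auto

lemma rec_eval_Comp4:
  "rec_eval g xs a \<Longrightarrow> rec_eval h xs b \<Longrightarrow> rec_eval k xs c \<Longrightarrow> rec_eval l xs d
    \<Longrightarrow> rec_eval f [a, b, c, d] z \<Longrightarrow> rec_eval (Comp f [g, h, k, l]) xs z"
  by (rule rec_eval.comp[where ys = "[a, b, c, d]"]) auto

lemma rec_eval_Proj:
  "rec_eval (Proj 0) (a # xs) a"
  "rec_eval (Proj (Suc 0)) (a # b # xs) b"
  "rec_eval (Proj 2) (a # b # c # xs) c"
  "rec_eval (Proj 3) (a # b # c # d # xs) d"
  using rec_eval.proj[of 0 "a # xs"] rec_eval.proj[of 1 "a # b # xs"]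
    rec_eval.proj[of 2 "a # b # c # xs"] rec_eval.proj[of 3 "a # b # c # d # xs"]
  by (simp_all add: eval_nat_numeral)

lemmas rec_eval_intros =
  rec_eval_Comp1 rec_eval_Comp2 rec_eval_Comp3 rec_eval_Comp4 rec_eval_Proj rec_eval.zero rec_eval.succ

lemma rec_eval_PrimRec:
  assumes "rec_eval f xs (p 0)" "\<And>n. rec_eval g (n # p n # xs) (p (Suc n))"
  shows "rec_eval (PrimRec f g) (n # xs) (p n)"
  by (induction n) (auto intro: rec_eval.primrec_0 rec_eval.primrec_Suc assms)

section \<open>Arithmetic and branching as recursive terms\<close>

primrec const_recf :: "nat \<Rightarrow> recf" where
  "const_recf 0 = Zero"
| "const_recf (Suc n) = Comp Succ [const_recf n]"

lemma rec_eval_const: "rec_eval (const_recf n) xs n"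
  by (induction n) (auto intro: rec_eval_intros)

definition pred_recf :: recf where
  "pred_recf = PrimRec Zero (Proj 0)"

lemma rec_eval_pred: "rec_eval pred_recf [n] (n - 1)"
  unfolding pred_recf_def
  by (rule rec_eval_PrimRec) (auto intro: rec_eval_intros)

definition add_recf :: recf where
  "add_recf = PrimRec (Proj 0) (Comp Succ [Proj (Suc 0)])"

lemma rec_eval_add: "rec_eval add_recf [m, n] (m + n)"
  unfolding add_recf_def
  by (rule rec_eval_PrimRec) (auto intro: rec_eval_intros)

text \<open>The arguments are swapped because recursion runs on the first argument, while it is the
  subtrahend that counts the predecessor steps.\<close>

definition sub_recf :: recf where
  "sub_recf = Comp (PrimRec (Proj 0) (Comp pred_recf [Proj (Suc 0)])) [Proj (Suc 0), Proj 0]"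

lemma rec_eval_sub: "rec_eval sub_recf [m, n] (m - n)"
proof -
  have *: "rec_eval (PrimRec (Proj 0) (Comp pred_recf [Proj (Suc 0)])) [n, m] (m - n)"
    by (rule rec_eval_PrimRec, simp add: rec_eval_intros)
      (rule rec_eval_eq, (rule rec_eval_intros rec_eval_pred)+, simp)
  show ?thesis
    unfolding sub_recf_def by (rule rec_eval_intros *)+
qed

text \<open>The step function sees the counter, the previous value and then both branches, so
  \<open>Proj 3\<close> selects the second branch for every positive counter.\<close>

definition if_zero_recf :: recf where
  "if_zero_recf = PrimRec (Proj 0) (Proj 3)"

lemma rec_eval_if_zero: "rec_eval if_zero_recf [c, a, b] (if c = 0 then a else b)"
  unfolding if_zero_recf_def
  by (rule rec_eval_PrimRec) (auto intro: rec_eval_intros)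

text \<open>The sum of the two truncated differences vanishes exactly when the numbers
  agree.\<close>

definition if_eq_recf :: recf where
  "if_eq_recf = Comp if_zero_recf
     [Comp add_recf [Comp sub_recf [Proj 0, Proj (Suc 0)], Comp sub_recf [Proj (Suc 0), Proj 0]],
      Proj 2, Proj 3]"

lemma rec_eval_if_eq: "rec_eval if_eq_recf [c, d, a, b] (if c = d then a else b)"
  unfolding if_eq_recf_def
  by (rule rec_eval_eq, (rule rec_eval_intros rec_eval_if_zero rec_eval_add rec_eval_sub)+) auto

section \<open>The Cantor pairing and its inverse\<close>

definition triangle_recf :: recf where
  "triangle_recf = PrimRec Zero (Comp add_recf [Proj (Suc 0), Comp Succ [Proj 0]])"

lemma rec_eval_triangle: "rec_eval triangle_recf [n] (triangle n)"
  unfolding triangle_recf_def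
  by (rule rec_eval_PrimRec, simp add: rec_eval_intros)
    (rule rec_eval_eq, (rule rec_eval_intros rec_eval_add)+, simp)

definition pair_recf :: recf where
  "pair_recf = Comp add_recf [Comp triangle_recf [add_recf], Proj 0]"

lemma rec_eval_pair: "rec_eval pair_recf [m, n] (prod_encode (m, n))"
  unfolding pair_recf_def
  by (rule rec_eval_eq, (rule rec_eval_intros rec_eval_triangle rec_eval_add)+)
    (simp add: prod_encode_def)

text \<open>
  The root recovers \<open>m + n\<close> from \<open>prod_encode (m, n)\<close>; the comparison with a triangular number is
  a vanishing truncated subtraction, as in the term \<open>root_recf\<close>.
\<close>

primrec triangle_root :: "nat \<Rightarrow> nat" where
  "triangle_root 0 = 0"
| "triangle_root (Suc n) =
     (if triangle (Suc (triangle_root n)) - Suc n = 0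
      then Suc (triangle_root n) else triangle_root n)"

lemma triangle_root_bounds:
  "triangle (triangle_root n) \<le> n \<and> n < triangle (Suc (triangle_root n))"
  by (induction n) auto

lemma triangle_mono: "m \<le> n \<Longrightarrow> triangle m \<le> triangle n"
  by (induction n) (auto simp: le_Suc_eq)

text \<open>The code \<open>triangle (m + n) + m\<close> lies below the next triangular number, and
  the intervals between consecutive triangular numbers are disjoint.\<close>

lemma triangle_root_prod_encode: "triangle_root (prod_encode (m, n)) = m + n"
proof -
  let ?r = "triangle_root (prod_encode (m, n))"
  have le: "triangle ?r \<le> triangle (m + n) + m" "triangle (m + n) + m < triangle (Suc ?r)"
    using triangle_root_bounds[of "prod_encode (m, n)"] by (simp_all add: prod_encode_def)
  have "\<not> Suc (m + n) \<le> ?r" using le(1) triangle_mono[of "Suc (m + n)" ?r] by auto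
  moreover have "\<not> Suc ?r \<le> m + n" using le(2) triangle_mono[of "Suc ?r" "m + n"] by linarith
  ultimately show ?thesis by simp
qed

definition root_recf :: recf where
  "root_recf = PrimRec Zero
     (Comp if_zero_recf
       [Comp sub_recf [Comp triangle_recf [Comp Succ [Proj (Suc 0)]], Comp Succ [Proj 0]],
        Comp Succ [Proj (Suc 0)], Proj (Suc 0)])"

lemma rec_eval_root: "rec_eval root_recf [n] (triangle_root n)"
  unfolding root_recf_def
  by (rule rec_eval_PrimRec, simp add: rec_eval_intros)
    (rule rec_eval_eq,
      (rule rec_eval_intros rec_eval_if_zero rec_eval_sub rec_eval_triangle)+, simp)

definition fst_recf :: recf where
  "fst_recf = Comp sub_recf [Proj 0, Comp triangle_recf [root_recf]]"

definition snd_recf :: recf where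
  "snd_recf = Comp sub_recf [root_recf, fst_recf]"

lemma rec_eval_fst: "rec_eval fst_recf [n] (fst (prod_decode n))"
proof -
  obtain a b where n: "n = prod_encode (a, b)"
    by (metis prod_decode_inverse surj_pair)
  have "n - triangle (triangle_root n) = a"
    unfolding n triangle_root_prod_encode by (simp add: prod_encode_def)
  then show ?thesis
    unfolding fst_recf_def
    by - (rule rec_eval_eq, (rule rec_eval_intros rec_eval_sub rec_eval_triangle rec_eval_root)+,
        simp add: n)
qed

lemma rec_eval_snd: "rec_eval snd_recf [n] (snd (prod_decode n))"
proof -
  obtain a b where "n = prod_encode (a, b)"
    by (metis prod_decode_inverse surj_pair)
  then show ?thesis
    unfolding snd_recf_def
    by - (rule rec_eval_eq, (rule rec_eval_intros rec_eval_sub rec_eval_fst rec_eval_root)+,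
        simp add: triangle_root_prod_encode)
qed

definition iter_recf :: "recf \<Rightarrow> recf" where
  "iter_recf f = PrimRec (Proj 0) (Comp f [Proj (Suc 0)])"

lemma rec_eval_iter:
  assumes "\<And>s. rec_eval f [s] (p s)"
  shows "rec_eval (iter_recf f) [n, s] ((p ^^ n) s)"
  unfolding iter_recf_def
  by (rule rec_eval_PrimRec) (auto intro: rec_eval_intros assms)


section \<open>Recursive functions on list codes\<close>

definition hd_code :: "nat \<Rightarrow> nat" where
  "hd_code l = fst (prod_decode (l - 1))"

definition tl_code :: "nat \<Rightarrow> nat" where
  "tl_code l = snd (prod_decode (l - 1))"

definition cons_code :: "nat \<Rightarrow> nat \<Rightarrow> nat" where
  "cons_code a l = Suc (prod_encode (a, l))"

lemma list_code_simps [simp]: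
  "hd_code (list_encode (a # as)) = a"
  "tl_code (list_encode (a # as)) = list_encode as"
  "tl_code 0 = 0"
  "cons_code a (list_encode as) = list_encode (a # as)"
proof -
  \<comment> \<open>This default matters: it makes the coded tail of the empty list empty, in
    agreement with \<open>tl\<close>.\<close>
  have "prod_decode 0 = (0, 0)"
    using prod_encode_inverse[of "(0, 0)"] by (simp add: prod_encode_def)
  then show "tl_code 0 = 0" by (simp add: tl_code_def)
qed (simp_all add: hd_code_def tl_code_def cons_code_def)

lemma list_encode_eq_0 [simp]: "list_encode as = 0 \<longleftrightarrow> as = []"
  by (cases as) auto

text \<open>Lets the code of a list serve as the iteration count of a loop over it, so that the
  length never has to be computed.\<close>

lemma length_le_list_encode: "length as \<le> list_encode as"
  by (induction as) (auto intro: order_trans[OF _ le_prod_encode_2])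

definition hd_recf :: recf where
  "hd_recf = Comp fst_recf [pred_recf]"

definition tl_recf :: recf where
  "tl_recf = Comp snd_recf [pred_recf]"

definition cons_recf :: recf where
  "cons_recf = Comp Succ [pair_recf]"

lemma rec_eval_hd: "rec_eval hd_recf [l] (hd_code l)"
  unfolding hd_recf_def hd_code_def
  by (rule rec_eval_intros rec_eval_fst rec_eval_pred)+

lemma rec_eval_tl: "rec_eval tl_recf [l] (tl_code l)"
  unfolding tl_recf_def tl_code_def
  by (rule rec_eval_intros rec_eval_snd rec_eval_pred)+

lemma rec_eval_cons: "rec_eval cons_recf [a, l] (cons_code a l)"
  unfolding cons_recf_def cons_code_def
  by (rule rec_eval_intros rec_eval_pair)+

lemmas rec_eval_list_intros =
  rec_eval_if_zero rec_eval_fst rec_eval_snd rec_eval_pair rec_eval_hd rec_eval_tl rec_eval_cons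

text \<open>The states of the following two iterations are pairs coded by \<open>prod_encode\<close>.\<close>

definition revapp_step :: "nat \<Rightarrow> nat" where
  "revapp_step s = (let l = fst (prod_decode s); a = snd (prod_decode s) in
     if l = 0 then s else prod_encode (tl_code l, cons_code (hd_code l) a))"

definition revapp_step_recf :: recf where
  "revapp_step_recf = Comp if_zero_recf
     [fst_recf, Proj 0,
      Comp pair_recf
        [Comp tl_recf [fst_recf], Comp cons_recf [Comp hd_recf [fst_recf], snd_recf]]]"

lemma rec_eval_revapp_step: "rec_eval revapp_step_recf [s] (revapp_step s)"
  unfolding revapp_step_recf_def
  by (rule rec_eval_eq, (rule rec_eval_intros rec_eval_list_intros)+)
    (simp add: revapp_step_def Let_def)

text \<open>Each step moves one item to the accumulator. Once the first list is empty the state is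
  fixed, so surplus iterations are harmless.\<close>

lemma revapp_step_funpow:
  "length as \<le> n \<Longrightarrow> (revapp_step ^^ n) (prod_encode (list_encode as, list_encode bs)) =
     prod_encode (0, list_encode (rev as @ bs))"
proof (induction n arbitrary: as bs)
  case (Suc n)
  show ?case
  proof (cases as)
    case Nil
    then show ?thesis
      using Suc.IH[of "[]" bs] by (simp add: funpow_Suc_right revapp_step_def del: funpow.simps)
  next
    case (Cons a as')
    then have "revapp_step (prod_encode (list_encode as, list_encode bs)) =
        prod_encode (list_encode as', list_encode (a # bs))"
      using list_code_simps by (simp add: revapp_step_def Let_def del: list_encode.simps)
    with Cons Suc show ?thesis
      by (simp add: funpow_Suc_right del: funpow.simps list_encode.simps)
  qed
qed simp

definition revapp_recf :: recf where
  "revapp_recf = Comp snd_recf [Comp (iter_recf revapp_step_recf) [Proj 0, pair_recf]]"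

lemma rec_eval_revapp:
  "rec_eval revapp_recf [list_encode as, list_encode bs] (list_encode (rev as @ bs))"
  unfolding revapp_recf_def
  by (rule rec_eval_eq,
      (rule rec_eval_intros rec_eval_list_intros rec_eval_iter[of _ revapp_step] rec_eval_revapp_step)+)
    (simp add: revapp_step_funpow length_le_list_encode)

definition append_recf :: recf where
  "append_recf = Comp revapp_recf [Comp revapp_recf [Proj 0, Zero], Proj (Suc 0)]"

lemma rec_eval_append:
  "rec_eval append_recf [list_encode as, list_encode bs] (list_encode (as @ bs))"
proof -
  have 1: "rec_eval revapp_recf [list_encode as, 0] (list_encode (rev as))"
    using rec_eval_revapp[of as "[]"] by simp
  have 2: "rec_eval revapp_recf [list_encode (rev as), list_encode bs] (list_encode (as @ bs))"
    using rec_eval_revapp[of "rev as" bs] by simp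
  show ?thesis
    unfolding append_recf_def by (rule rec_eval_intros 1 2)+
qed

definition search_step :: "nat \<Rightarrow> nat" where
  "search_step s = (let q = fst (prod_decode s); l = snd (prod_decode s) in
     if l = 0 then s else if hd_code l = q then s else prod_encode (q, tl_code l))"

definition search_step_recf :: recf where
  "search_step_recf = Comp if_zero_recf
     [snd_recf, Proj 0,
      Comp if_eq_recf
        [Comp hd_recf [snd_recf], fst_recf, Proj 0,
         Comp pair_recf [fst_recf, Comp tl_recf [snd_recf]]]]"

lemma rec_eval_search_step: "rec_eval search_step_recf [s] (search_step s)"
  unfolding search_step_recf_def
  by (rule rec_eval_eq, (rule rec_eval_intros rec_eval_list_intros rec_eval_if_eq)+)
    (simp add: search_step_def Let_def)

text \<open>Both a match at the head and an empty remainder are fixed points, so the search may run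
  too long; the final remainder is empty exactly when \<open>q\<close> is absent.\<close>

lemma search_step_funpow:
  "length as \<le> n \<Longrightarrow> (search_step ^^ n) (prod_encode (q, list_encode as)) =
     prod_encode (q, list_encode (dropWhile (\<lambda>a. a \<noteq> q) as))"
proof (induction n arbitrary: as)
  case (Suc n)
  show ?case
  proof (cases as)
    case Nil
    then show ?thesis
      using Suc.IH[of "[]"] by (simp add: funpow_Suc_right search_step_def del: funpow.simps)
  next
    case (Cons a as')
    have "search_step (prod_encode (q, list_encode as)) =
        prod_encode (q, list_encode (if a = q then as else as'))"
      using Cons list_code_simps by (simp add: search_step_def Let_def del: list_encode.simps)
    moreover have "((search_step ^^ n) (prod_encode (q, list_encode as))) =
        prod_encode (q, list_encode as)" if "a = q"
    proof -
      from that calculation have "search_step (prod_encode (q, list_encode as)) =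
          prod_encode (q, list_encode as)" by simp
      then show ?thesis by (induction n) simp_all
    qed
    ultimately show ?thesis
      using Cons Suc by (auto simp: funpow_Suc_right simp del: funpow.simps list_encode.simps)
  qed
qed simp

text \<open>A zero remainder means absence, hence the reversed order of the branches.\<close>

definition if_mem_recf :: recf where
  "if_mem_recf = Comp if_zero_recf
     [Comp snd_recf
       [Comp (iter_recf search_step_recf)
         [Proj (Suc 0), Comp pair_recf [Proj 0, Proj (Suc 0)]]],
      Proj 3, Proj 2]"

lemma rec_eval_if_mem:
  "rec_eval if_mem_recf [q, list_encode as, a, b] (if q \<in> set as then a else b)"
proof -
  have "dropWhile (\<lambda>a. a \<noteq> q) as = [] \<longleftrightarrow> q \<notin> set as"
    by (auto simp: dropWhile_eq_Nil_conv)
  then show ?thesis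
    unfolding if_mem_recf_def
    by - (rule rec_eval_eq,
        (rule rec_eval_intros rec_eval_list_intros rec_eval_iter[of _ search_step]
          rec_eval_search_step)+,
        simp add: search_step_funpow length_le_list_encode)
qed


section \<open>Recursive maps on data\<close>

locale numbered_model = standard_model M
  for M :: "('d, 'm) algorithm_model_scheme" +
  fixes code :: "'d \<Rightarrow> nat"
  assumes numbering: "effective_numbering M code"
begin

text \<open>Number-valued maps are kept apart from data-valued ones because packed lists of codes
  occur as intermediate values that are not themselves treated as codes of data.\<close>

definition recursive_map :: "('d \<Rightarrow> nat) \<Rightarrow> bool" where
  "recursive_map F \<longleftrightarrow> (\<exists>r. \<forall>x. rec_eval r [code x] (F x))"

definition data_map :: "('d \<Rightarrow> 'd) \<Rightarrow> bool" where
  "data_map f \<longleftrightarrow> recursive_map (\<lambda>x. code (f x))"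

text \<open>The fallback values here and below make all decoders total, so that algorithms composed
  from them halt on every datum.\<close>

definition items :: "'d \<Rightarrow> 'd list" where
  "items x = (if x \<in> range (lst M) then inv (lst M) x else [])"

definition head :: "'d \<Rightarrow> 'd" where
  "head x = (case items x of [] \<Rightarrow> x | d # _ \<Rightarrow> d)"

definition rest :: "'d \<Rightarrow> 'd" where
  "rest x = lst M (tl (items x))"

definition numval :: "'d \<Rightarrow> nat" where
  "numval x = (if x \<in> range (num M) then inv (num M) x else 0)"

lemma inj_code: "inj code"
  using numbering by (simp add: effective_numbering_def)

lemma items_lst [simp]: "items (lst M ds) = ds"
  by (simp add: items_def lst_inj)

lemma head_lst [simp]: "head (lst M (d # ds)) = d"
  by (simp add: head_def)

lemma rest_lst [simp]: "rest (lst M (d # ds)) = lst M ds"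
  by (simp add: rest_def)

lemma numval_num [simp]: "numval (num M n) = n"
  by (simp add: numval_def num_inj)

lemma num_eq_iff [simp]: "num M m = num M n \<longleftrightarrow> m = n"
  using num_inj by (auto dest: injD)

lemma lst_eq_iff [simp]: "lst M as = lst M bs \<longleftrightarrow> as = bs"
  using lst_inj by (auto dest: injD)

lemma recursive_map_const: "recursive_map (\<lambda>x. n)"
  unfolding recursive_map_def using rec_eval_const by blast

lemma recursive_map_comp1:
  assumes "\<And>x. rec_eval r [F x] (p x)" "recursive_map F"
  shows "recursive_map p"
  using assms unfolding recursive_map_def by (meson rec_eval_Comp1)

lemma recursive_map_comp2:
  assumes "\<And>x. rec_eval r [F x, G x] (p x)" "recursive_map F" "recursive_map G"
  shows "recursive_map p"
  using assms unfolding recursive_map_def by (meson rec_eval_Comp2)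

lemma recursive_map_comp3:
  assumes "\<And>x. rec_eval r [F x, G x, H x] (p x)" "recursive_map F" "recursive_map G" "recursive_map H"
  shows "recursive_map p"
  using assms unfolding recursive_map_def by (meson rec_eval_Comp3)

lemma recursive_map_comp4:
  assumes "\<And>x. rec_eval r [F x, G x, H x, K x] (p x)"
    and "recursive_map F" "recursive_map G" "recursive_map H" "recursive_map K"
  shows "recursive_map p"
  using assms unfolding recursive_map_def by (meson rec_eval_Comp4)

lemma data_map_id: "data_map (\<lambda>x. x)"
  unfolding data_map_def recursive_map_def using rec_eval_Proj(1) by blast

lemma data_map_const: "data_map (\<lambda>x. d)"
  unfolding data_map_def by (rule recursive_map_const)

lemma recursive_map_data_map:
  assumes "recursive_map F" "data_map g"
  shows "recursive_map (\<lambda>x. F (g x))"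
proof -
  obtain r where "\<And>x. rec_eval r [code x] (F x)"
    using assms(1) unfolding recursive_map_def by blast
  then show ?thesis
    using assms(2) unfolding data_map_def by (rule recursive_map_comp1)
qed

lemma data_map_compose: "data_map f \<Longrightarrow> data_map g \<Longrightarrow> data_map (\<lambda>x. f (g x))"
  unfolding data_map_def[of f] data_map_def[of "\<lambda>x. f (g x)"] by (rule recursive_map_data_map)

text \<open>
  Decoders are only specified on codes of the right kind; replacing other data by a fixed
  \<open>d\<close> of that kind makes them total.
\<close>

lemma recursive_map_totalize:
  assumes "code_decidable code D" "d \<in> D" "\<And>x. x \<in> D \<Longrightarrow> rec_eval r [code x] (F x)"
  shows "recursive_map (\<lambda>x. F (if x \<in> D then x else d))"
proof (rule recursive_map_comp1)
  show "rec_eval r [code (if x \<in> D then x else d)] (F (if x \<in> D then x else d))" for x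
    using assms by simp
  obtain s where s: "\<And>x. rec_eval s [code x] (if x \<in> D then 1 else 0)"
    using assms(1) unfolding code_decidable_def by blast
  show "recursive_map (\<lambda>x. code (if x \<in> D then x else d))"
  proof (rule recursive_map_comp3)
    show "rec_eval if_zero_recf [if x \<in> D then 1 else 0, code d, code x]
        (code (if x \<in> D then x else d))" for x
      using rec_eval_if_zero[of "if x \<in> D then 1 else 0" "code d" "code x"] by (simp split: if_splits)
    show "recursive_map (\<lambda>x. if x \<in> D then 1 else 0)"
      unfolding recursive_map_def using s by blast
    show "recursive_map (\<lambda>x. code d)" by (rule recursive_map_const)
    show "recursive_map code" using data_map_id by (simp add: data_map_def)
  qed
qed

lemma recursive_map_items: "recursive_map (\<lambda>x. list_encode (map code (items x)))"
proof -
  obtain r where r: "\<And>ds. rec_eval r [code (lst M ds)] (list_encode (map code ds))"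
    using numbering unfolding effective_numbering_def by blast
  have "recursive_map (\<lambda>x. list_encode (map code (items (if x \<in> range (lst M) then x else lst M []))))"
    by (rule recursive_map_totalize[where r = r])
      (use numbering r in \<open>auto simp: effective_numbering_def\<close>)
  \<comment> \<open>The replacement datum is chosen to have the items of a non-list, namely none;
    \<open>num M 0\<close> plays the same role for \<open>numval\<close>.\<close>
  moreover have "items (if x \<in> range (lst M) then x else lst M []) = items x" for x
    by (simp add: items_def lst_inj)
  ultimately show ?thesis by simp
qed

lemma recursive_map_numval: "recursive_map numval"
proof -
  obtain r where r: "\<And>n. rec_eval r [code (num M n)] n"
    using numbering unfolding effective_numbering_def by blast
  have "recursive_map (\<lambda>x. numval (if x \<in> range (num M) then x else num M 0))"
    by (rule recursive_map_totalize[where r = r])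
      (use numbering r in \<open>auto simp: effective_numbering_def\<close>)
  moreover have "numval (if x \<in> range (num M) then x else num M 0) = numval x" for x
    by (simp add: numval_def num_inj)
  ultimately show ?thesis by simp
qed

text \<open>The recursive encoder and decoder for lists convert between the two sides, which reduces
  list operations on data to those on \<open>list_encode\<close>.\<close>

lemma data_map_lst_iff:
  "data_map (\<lambda>x. lst M (F x)) \<longleftrightarrow> recursive_map (\<lambda>x. list_encode (map code (F x)))"
proof
  assume "data_map (\<lambda>x. lst M (F x))"
  from recursive_map_data_map[OF recursive_map_items this]
  show "recursive_map (\<lambda>x. list_encode (map code (F x)))" by simp
next
  assume F: "recursive_map (\<lambda>x. list_encode (map code (F x)))"
  obtain r where "\<And>ds. rec_eval r [list_encode (map code ds)] (code (lst M ds))"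
    using numbering unfolding effective_numbering_def by blast
  then show "data_map (\<lambda>x. lst M (F x))"
    unfolding data_map_def by (rule recursive_map_comp1[OF _ F])
qed

lemma data_map_Nil: "data_map (\<lambda>x. lst M [])"
  by (rule data_map_const)

lemma data_map_Cons:
  assumes "data_map f" "data_map (\<lambda>x. lst M (F x))"
  shows "data_map (\<lambda>x. lst M (f x # F x))"
  unfolding data_map_lst_iff
proof (rule recursive_map_comp2)
  show "rec_eval cons_recf [code (f x), list_encode (map code (F x))]
      (list_encode (map code (f x # F x)))" for x
    using rec_eval_cons[of "code (f x)" "list_encode (map code (F x))"]
    by (simp del: list_encode.simps)
qed (use assms in \<open>simp_all add: data_map_def data_map_lst_iff[symmetric]\<close>)

lemma data_map_append:
  assumes "data_map (\<lambda>x. lst M (F x))" "data_map (\<lambda>x. lst M (G x))"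
  shows "data_map (\<lambda>x. lst M (F x @ G x))"
  unfolding data_map_lst_iff
proof (rule recursive_map_comp2)
  show "rec_eval append_recf [list_encode (map code (F x)), list_encode (map code (G x))]
      (list_encode (map code (F x @ G x)))" for x
    using rec_eval_append by simp
qed (use assms in \<open>simp_all add: data_map_lst_iff\<close>)

text \<open>Injectivity of \<open>code\<close> turns membership of data into membership of
  codes.\<close>

lemma data_map_if_mem:
  assumes "data_map q" "data_map (\<lambda>x. lst M (F x))" "data_map a" "data_map b"
  shows "data_map (\<lambda>x. if q x \<in> set (F x) then a x else b x)"
  unfolding data_map_def
proof (rule recursive_map_comp4)
  show "rec_eval if_mem_recf [code (q x), list_encode (map code (F x)), code (a x), code (b x)]
      (code (if q x \<in> set (F x) then a x else b x))" for x
    using rec_eval_if_mem[of "code (q x)" "map code (F x)" "code (a x)" "code (b x)"]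
    by (simp add: inj_image_mem_iff[OF inj_code] if_distrib[of code] cong: if_cong)
qed (use assms in \<open>simp_all add: data_map_lst_iff data_map_def\<close>)

lemma data_map_head: "data_map head"
  unfolding data_map_def
proof (rule recursive_map_comp3)
  show "rec_eval if_zero_recf
      [list_encode (map code (items x)), code x, hd_code (list_encode (map code (items x)))]
      (code (head x))" for x
    by (rule rec_eval_eq[OF rec_eval_if_zero])
      (simp add: head_def split: list.split del: list_encode.simps(2))
  show "recursive_map (\<lambda>x. hd_code (list_encode (map code (items x))))"
    by (rule recursive_map_comp1[OF rec_eval_hd recursive_map_items])
qed (use data_map_id recursive_map_items in \<open>simp_all add: data_map_def\<close>)

lemma data_map_rest: "data_map rest"
  unfolding rest_def data_map_lst_iff
proof (rule recursive_map_comp1[OF _ recursive_map_items])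
  show "rec_eval tl_recf [list_encode (map code (items x))] (list_encode (map code (tl (items x))))"
    for x
    by (rule rec_eval_eq[OF rec_eval_tl]) (cases "items x"; simp del: list_encode.simps(2))
qed

lemma data_map_items: "data_map f \<Longrightarrow> data_map (\<lambda>x. lst M (items (f x)))"
  unfolding data_map_lst_iff by (rule recursive_map_data_map[OF recursive_map_items])

lemma data_map_num_pred: "data_map (\<lambda>x. num M (numval x - 1))"
proof -
  obtain r where r: "\<And>n. rec_eval r [n] (code (num M n))"
    using numbering unfolding effective_numbering_def by blast
  show ?thesis
    unfolding data_map_def
    by (rule recursive_map_comp1[OF r], rule recursive_map_comp1[OF rec_eval_pred],
        rule recursive_map_numval)
qed

section \<open>From recursive maps to algorithms\<close>

lemma exists_algorithm:
  "(\<And>x z. rec_eval r [code x] z \<longleftrightarrow> (\<exists>y. g x = Some y \<and> z = code y)) \<Longrightarrow>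
     \<exists>\<alpha>\<in>algs M. \<forall>x. run M \<alpha> x = g x"
  using numbering unfolding effective_numbering_def by blast

lemma data_map_algorithm:
  assumes "data_map f"
  shows "\<exists>\<alpha>\<in>algs M. \<forall>x. run M \<alpha> x = Some (f x)"
proof -
  obtain r where "\<And>x. rec_eval r [code x] (code (f x))"
    using assms unfolding data_map_def recursive_map_def by blast
  then show ?thesis
    by (intro exists_algorithm[of r]) (auto dest: rec_eval_deterministic)
qed

text \<open>Composes the uniform evaluator with the total maps \<open>a\<close> and
  \<open>h\<close>; the result halts exactly when the simulated process does. It serves both to
  splice libraries and to build the Curry algorithm.\<close>

lemma universal_algorithm:
  assumes "data_map a" "\<And>x. a x \<in> algs M" "data_map h"
  shows "\<exists>\<alpha>\<in>algs M. \<forall>x. run M \<alpha> x = run M (a x) (h x)"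
proof -
  obtain r where r: "\<And>\<alpha> x z. \<alpha> \<in> algs M \<Longrightarrow>
      rec_eval r [code \<alpha>, code x] z \<longleftrightarrow> (\<exists>y. run M \<alpha> x = Some y \<and> z = code y)"
    using numbering unfolding effective_numbering_def by blast
  obtain ra where ra: "\<And>x. rec_eval ra [code x] (code (a x))"
    using assms(1) unfolding data_map_def recursive_map_def by blast
  obtain rh where rh: "\<And>x. rec_eval rh [code x] (code (h x))"
    using assms(3) unfolding data_map_def recursive_map_def by blast
  \<comment> \<open>The forward direction inverts the composition; determinism then identifies the
    intermediate values with the two codes.\<close>
  have "rec_eval (Comp r [ra, rh]) [code x] z \<longleftrightarrow> rec_eval r [code (a x), code (h x)] z" for x z
  proof
    assume "rec_eval (Comp r [ra, rh]) [code x] z"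
    then show "rec_eval r [code (a x), code (h x)] z"
    proof cases
      case (comp ys)
      then obtain y y' where "ys = [y, y']" "rec_eval ra [code x] y" "rec_eval rh [code x] y'"
        by (auto simp: list_all2_Cons1)
      with ra rh comp show ?thesis by (metis rec_eval_deterministic)
    qed
  qed (rule rec_eval_Comp2[OF ra rh])
  then show ?thesis
    using r assms(2) by (intro exists_algorithm[of "Comp r [ra, rh]"]) simp
qed


section \<open>Construction of rules and libraries\<close>

text \<open>Monotonicity holds because a larger hypothesis list can only switch the condition on,
  and the appended list depends on the nominal library alone.\<close>

lemma conditional_rule:
  assumes "data_map P" "data_map (\<lambda>\<rho>. lst M (Cs \<rho>))" "\<And>\<rho>. set (Cs \<rho>) \<subseteq> stmts M"
  obtains r where "is_rule M r"
    "\<And>H \<rho> m. run M r (lst M [lst M H, \<rho>, num M m]) =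
       Some (lst M (if P \<rho> \<in> set H then H @ Cs \<rho> else H))"
proof -
  let ?H = "\<lambda>x. items (head x)" and ?\<rho> = "\<lambda>x. head (rest x)"
  have \<rho>: "data_map ?\<rho>"
    by (rule data_map_compose[OF data_map_head data_map_rest])
  have H: "data_map (\<lambda>x. lst M (?H x))"
    by (rule data_map_items[OF data_map_head])
  have "data_map (\<lambda>x. if P (?\<rho> x) \<in> set (?H x) then lst M (?H x @ Cs (?\<rho> x)) else lst M (?H x))"
    by (rule data_map_if_mem[OF data_map_compose[OF assms(1) \<rho>] H
          data_map_append[OF H data_map_compose[OF assms(2) \<rho>]] H])
  from data_map_algorithm[OF this] obtain r where r: "r \<in> algs M"
    "\<And>x. run M r x =
       Some (if P (?\<rho> x) \<in> set (?H x) then lst M (?H x @ Cs (?\<rho> x)) else lst M (?H x))"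
    by blast
  then have run: "run M r (lst M [lst M H, \<rho>, num M m]) =
      Some (lst M (if P \<rho> \<in> set H then H @ Cs \<rho> else H))" for H \<rho> m
    by simp
  then have "is_rule M r"
    using r(1) assms(3) unfolding is_rule_def outputs_def by (auto split: if_splits)
  then show thesis using run by (rule that)
qed

lemma singleton_library:
  assumes "is_rule M r"
  shows "\<exists>\<rho>. is_library M \<rho> \<and> seq_terms M \<rho> = {r}"
proof -
  obtain \<rho> where "\<rho> \<in> algs M" "\<And>x. run M \<rho> x = Some r"
    using data_map_algorithm[OF data_map_const] by blast
  then have "is_library M \<rho> \<and> seq_terms M \<rho> = {r}"
    using assms by (auto simp: is_library_def alg_seqs_def halts_def seq_terms_def seq_term_def)
  then show ?thesis by blast
qed

text \<open>The new library has \<open>r\<close> as first term, followed by the terms of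
  \<open>\<sigma>\<close> shifted by one.\<close>

lemma insert_library:
  assumes "is_rule M r" "is_library M \<sigma>"
  shows "\<exists>\<rho>. is_library M \<rho> \<and> seq_terms M \<rho> = insert r (seq_terms M \<sigma>)"
proof -
  have \<sigma>: "\<sigma> \<in> algs M" "\<And>n. n > 0 \<Longrightarrow> halts M \<sigma> (num M n)"
    using assms(2) by (auto simp: is_library_def alg_seqs_def)
  obtain c where c: "c \<in> algs M" "\<And>x. run M c x = Some r"
    using data_map_algorithm[OF data_map_const] by blast
  \<comment> \<open>On input 1 the shifted argument is 0, where \<open>\<sigma>\<close> need not
    halt; the constant algorithm takes over there.\<close>
  let ?a = "\<lambda>x. if x \<in> set [num M 1] then c else \<sigma>"
  have "data_map ?a"
    by (intro data_map_if_mem data_map_id data_map_const)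
  moreover have "?a x \<in> algs M" for x using c(1) \<sigma>(1) by simp
  ultimately have "\<exists>\<rho>\<in>algs M. \<forall>x. run M \<rho> x = run M (?a x) (num M (numval x - 1))"
    by (rule universal_algorithm[OF _ _ data_map_num_pred])
  then obtain \<rho> where \<rho>: "\<rho> \<in> algs M"
    "\<And>x. run M \<rho> x = run M (?a x) (num M (numval x - 1))"
    by blast
  have run: "run M \<rho> (num M 1) = Some r"
    "\<And>n. n > 0 \<Longrightarrow> run M \<rho> (num M (Suc n)) = run M \<sigma> (num M n)"
    using \<rho>(2) c(2) by simp_all
  have "halts M \<rho> (num M n)" if "n > 0" for n
  proof (cases "n = 1")
    case False
    with that obtain k where "n = Suc k" "k > 0" by (cases n) auto
    then show ?thesis using run(2) \<sigma>(2) by (simp add: halts_def)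
  qed (use run(1) in \<open>simp add: halts_def\<close>)
  then have "\<rho> \<in> alg_seqs M" using \<rho>(1) by (simp add: alg_seqs_def)
  moreover have "seq_terms M \<rho> = insert r (seq_terms M \<sigma>)"
  proof (intro set_eqI iffI)
    fix s assume "s \<in> seq_terms M \<rho>"
    then obtain n where n: "n > 0" "s = seq_term M \<rho> n" by (auto simp: seq_terms_def)
    show "s \<in> insert r (seq_terms M \<sigma>)"
    proof (cases "n = 1")
      case False
      with n(1) obtain k where "n = Suc k" "k > 0" by (cases n) auto
      then show ?thesis using run(2) n(2) by (auto simp: seq_terms_def seq_term_def)
    qed (use run(1) n(2) in \<open>simp add: seq_term_def\<close>)
  next
    fix s assume "s \<in> insert r (seq_terms M \<sigma>)"
    then consider "s = r" | n where "n > 0" "s = seq_term M \<sigma> n" by (auto simp: seq_terms_def)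
    then show "s \<in> seq_terms M \<rho>"
    proof cases
      case 1
      then have "s = seq_term M \<rho> 1" using run(1) by (simp add: seq_term_def)
      then show ?thesis unfolding seq_terms_def by blast
    next
      case 2
      then have "s = seq_term M \<rho> (Suc n)" using run(2) by (simp add: seq_term_def)
      then show ?thesis unfolding seq_terms_def by blast
    qed
  qed
  ultimately show ?thesis
    using assms by (intro exI[of _ \<rho>]) (simp add: is_library_def)
qed

lemma insert_base_library:
  assumes "is_base M \<B>" "is_rule M r"
  shows "\<exists>\<rho>. is_library M \<rho> \<and> seq_terms M \<rho> = insert r \<B>"
proof -
  have rules: "\<And>s. s \<in> \<B> \<Longrightarrow> is_rule M s" using assms(1) by (simp add: is_base_def)
  show ?thesis
  proof (cases "finite \<B>")
    case True
    then show ?thesis using rules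
    proof (induction \<B>)
      \<comment> \<open>The rule \<open>r\<close> itself supplies the terms, so the induction can
        start even though a library cannot have an empty set of terms.\<close>
      case empty
      then show ?case using singleton_library[OF assms(2)] by simp
    next
      case (insert s \<B>)
      then obtain \<rho> where "is_library M \<rho>" "seq_terms M \<rho> = Set.insert r \<B>" by auto
      with insert_library[of s \<rho>] insert.prems show ?case by (auto simp: insert_commute)
    qed
  next
    case False
    then obtain \<sigma> where "is_library M \<sigma>" "\<B> = seq_terms M \<sigma>"
      using assms(1) by (auto simp: is_base_def)
    then show ?thesis using insert_library[OF assms(2)] by blast
  qed
qed

end


section \<open>Deduction\<close>

context algorithmic_logic
begin

lemma lst_eq_iff [simp]: "lst M as = lst M bs \<longleftrightarrow> as = bs"
  using lst_inj by (auto dest: injD)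

lemma true_stmts_iff: "lst M [\<alpha>, u, v] \<in> true_stmts M \<longleftrightarrow> \<alpha> \<in> algs M \<and> run M \<alpha> u = Some v"
  by (auto simp: true_stmts_def)

lemma stmts_iff: "lst M [\<alpha>, u, v] \<in> stmts M \<longleftrightarrow> \<alpha> \<in> algs M"
  by (auto simp: stmts_def)

lemma true_stmts_subset: "true_stmts M \<subseteq> stmts M"
  by (auto simp: true_stmts_def stmts_def)

lemma turnstile_stmt: "turnstile M \<Gamma> \<rho> B \<in> stmts M"
  by (simp add: turnstile_def stmts_iff deduce_alg)

lemma neg_stmt: "neg M \<rho> A \<in> stmts M"
  by (simp add: neg_def conditional_def turnstile_stmt)

lemma or_stmt_stmt: "or_stmt M A B \<in> stmts M"
  by (simp add: or_stmt_def stmts_iff or_alg)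

lemma falsum_stmt: "falsum M \<in> stmts M"
  by (simp add: falsum_def stmts_iff identity_alg)

lemma falsum_not_true: "falsum M \<notin> true_stmts M"
  using num_inj by (auto simp: falsum_def true_stmts_iff identity_run dest: injD)

lemma or_stmt_true:
  "A \<in> stmts M \<Longrightarrow> B \<in> stmts M \<Longrightarrow> A \<in> true_stmts M \<or> B \<in> true_stmts M
    \<Longrightarrow> or_stmt M A B \<in> true_stmts M"
  by (simp add: or_stmt_def true_stmts_iff or_alg or_run)

lemma outputs_unique: "outputs M r H \<rho> m C \<Longrightarrow> outputs M r H \<rho> m C' \<Longrightarrow> C = C'"
  by (simp add: outputs_def)

lemma rule_outputs:
  assumes "is_library M \<rho>" "k > 0" "set H \<subseteq> stmts M" "m > 0"
  shows "\<exists>C. outputs M (seq_term M \<rho> k) H \<rho> m C \<and> set C \<subseteq> stmts M \<and> prefix H C"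
proof -
  have "is_rule M (seq_term M \<rho> k)" "\<rho> \<in> alg_seqs M"
    using assms by (auto simp: is_library_def seq_terms_def)
  then show ?thesis using assms(3,4) unfolding is_rule_def by blast
qed

lemma enum_pairs_pos: "enum_pairs M (Suc i) = (k, m) \<Longrightarrow> k > 0 \<and> m > 0"
  using bij_betwE[OF enum_bij] by (force dest: bspec[of _ _ "Suc i"])

text \<open>The definite description in \<open>deduction\<close> is known to denote an output only
  while the current list consists of statements, so this invariant is carried along with the
  step.\<close>

lemma deduction_step:
  assumes "is_library M \<rho>" "set \<Gamma> \<subseteq> stmts M"
  shows "set (deduction M \<Gamma> \<rho> i) \<subseteq> stmts M"
    and "enum_pairs M (Suc i) = (k, m) \<Longrightarrow>
      outputs M (seq_term M \<rho> k) (deduction M \<Gamma> \<rho> i) \<rho> m (deduction M \<Gamma> \<rho> (Suc i))"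
    and "set (deduction M \<Gamma> \<rho> i) \<subseteq> set (deduction M \<Gamma> \<rho> (Suc i))"
proof -
  have step: "outputs M (seq_term M \<rho> (fst (enum_pairs M (Suc i)))) (deduction M \<Gamma> \<rho> i) \<rho>
        (snd (enum_pairs M (Suc i))) (deduction M \<Gamma> \<rho> (Suc i)) \<and>
      set (deduction M \<Gamma> \<rho> (Suc i)) \<subseteq> stmts M \<and>
      set (deduction M \<Gamma> \<rho> i) \<subseteq> set (deduction M \<Gamma> \<rho> (Suc i))"
    if "set (deduction M \<Gamma> \<rho> i) \<subseteq> stmts M" for i
  proof -
    obtain k m where km: "enum_pairs M (Suc i) = (k, m)" by fastforce
    then have "k > 0" "m > 0" using enum_pairs_pos by auto
    then obtain C where C: "outputs M (seq_term M \<rho> k) (deduction M \<Gamma> \<rho> i) \<rho> m C"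
      "set C \<subseteq> stmts M" "prefix (deduction M \<Gamma> \<rho> i) C"
      using rule_outputs[OF assms(1)] \<open>set (deduction M \<Gamma> \<rho> i) \<subseteq> stmts M\<close> by blast
    then have "(THE C. outputs M (seq_term M \<rho> k) (deduction M \<Gamma> \<rho> i) \<rho> m C) = C"
      by (blast intro: the_equality outputs_unique)
    with C km show ?thesis by (simp add: set_mono_prefix)
  qed
  have stmts: "set (deduction M \<Gamma> \<rho> i) \<subseteq> stmts M" for i
    by (induction i) (use assms(2) step in auto)
  show "set (deduction M \<Gamma> \<rho> i) \<subseteq> stmts M" by (rule stmts)
  show "outputs M (seq_term M \<rho> k) (deduction M \<Gamma> \<rho> i) \<rho> m (deduction M \<Gamma> \<rho> (Suc i))"
    if "enum_pairs M (Suc i) = (k, m)"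
    using step[OF stmts] that by (metis fst_conv snd_conv)
  show "set (deduction M \<Gamma> \<rho> i) \<subseteq> set (deduction M \<Gamma> \<rho> (Suc i))"
    using step[OF stmts] by blast
qed

lemma deduction_mono:
  assumes "is_library M \<rho>" "set \<Gamma> \<subseteq> stmts M" "i \<le> j"
  shows "set (deduction M \<Gamma> \<rho> i) \<subseteq> set (deduction M \<Gamma> \<rho> j)"
  using deduction_step(3)[OF assms(1,2)] assms(3) by (rule lift_Suc_mono_le)

text \<open>
  Each pair of a rule and a resource integer is used only once in a deduction, but a later
  stage uses the same rule with a larger resource integer, which suffices by monotonicity.
\<close>

lemma deduction_closed:
  assumes "is_library M \<rho>" "set \<Gamma> \<subseteq> stmts M" "set H \<subseteq> set (deduction M \<Gamma> \<rho> i)"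
    and "k > 0" "m > 0" "outputs M (seq_term M \<rho> k) H \<rho> m C"
  shows "\<exists>j. set C \<subseteq> set (deduction M \<Gamma> \<rho> j)"
proof -
  \<comment> \<open>Infinitely many pairs use rule \<open>k\<close> with a sufficient resource, and
    only finitely many are spent by stage \<open>i\<close>. The range \<open>{..i}\<close> also
    contains index 0, where \<open>enum_pairs\<close> is unconstrained; this excludes at most one
    further pair.\<close>
  have "infinite ((\<lambda>m'. (k, m')) ` {m..})"
    by (simp add: finite_image_iff inj_on_def infinite_Ici)
  then have "\<not> (\<lambda>m'. (k, m')) ` {m..} \<subseteq> enum_pairs M ` {..i}"
    by (meson finite_atMost finite_imageI finite_subset)
  then obtain m' where m': "m \<le> m'" "(k, m') \<notin> enum_pairs M ` {..i}" by auto
  have "(k, m') \<in> {1..} \<times> {1..}" using assms(4,5) m'(1) by auto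
  then have "(k, m') \<in> enum_pairs M ` {1..}" using enum_bij by (simp add: bij_betw_def)
  then obtain l where l: "l \<ge> 1" "enum_pairs M l = (k, m')" by force
  with m'(2) have "i < l" by (force simp: not_le[symmetric])
  then obtain j where j: "l = Suc j" "i \<le> j" by (cases l) auto
  have "outputs M (seq_term M \<rho> k) (deduction M \<Gamma> \<rho> j) \<rho> m' (deduction M \<Gamma> \<rho> (Suc j))"
    using deduction_step(2)[OF assms(1,2)] l(2) j(1) by blast
  moreover have "set H \<subseteq> set (deduction M \<Gamma> \<rho> j)"
    using assms(3) deduction_mono[OF assms(1,2) j(2)] by blast
  moreover have "set (deduction M \<Gamma> \<rho> j) \<subseteq> stmts M" by (rule deduction_step(1)[OF assms(1,2)])
  moreover have "is_rule M (seq_term M \<rho> k)" "\<rho> \<in> alg_seqs M"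
    using assms(1,4) by (auto simp: is_library_def seq_terms_def)
  ultimately have "set C \<subseteq> set (deduction M \<Gamma> \<rho> (Suc j))"
    using assms(5,6) m'(1) unfolding is_rule_def by (meson subset_trans)
  then show ?thesis by blast
qed

text \<open>Cut: each step of the deduction from \<open>\<Delta>\<close> is absorbed into a later
  stage of the deduction from \<open>\<Gamma>\<close> by \<open>deduction_closed\<close>.\<close>

lemma deduction_cut:
  assumes "is_library M \<rho>" "set \<Gamma> \<subseteq> stmts M" "set \<Delta> \<subseteq> set (deduction M \<Gamma> \<rho> i)"
  shows "\<exists>j. set (deduction M \<Delta> \<rho> n) \<subseteq> set (deduction M \<Gamma> \<rho> j)"
proof (induction n)
  case 0
  then show ?case using assms(3) by auto
next
  case (Suc n)
  have \<Delta>: "set \<Delta> \<subseteq> stmts M" using assms(3) deduction_step(1)[OF assms(1,2)] by blast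
  obtain k m where km: "enum_pairs M (Suc n) = (k, m)" by fastforce
  with Suc deduction_closed[OF assms(1,2)] deduction_step(2)[OF assms(1) \<Delta> km] enum_pairs_pos
  show ?case by metis
qed

lemma deduction_sound:
  assumes "valid_library M \<rho>" "set \<Gamma> \<subseteq> true_stmts M"
  shows "set (deduction M \<Gamma> \<rho> i) \<subseteq> true_stmts M"
proof (induction i)
  case 0
  then show ?case using assms(2) by simp
next
  case (Suc i)
  obtain k m where km: "enum_pairs M (Suc i) = (k, m)" by fastforce
  have \<Gamma>: "set \<Gamma> \<subseteq> stmts M" using assms(2) true_stmts_subset by blast
  have lib: "is_library M \<rho>" using assms(1) by (simp add: valid_library_def)
  have "k > 0" "m > 0" using enum_pairs_pos[OF km] by auto
  moreover from this have "valid_rule M \<rho> (seq_term M \<rho> k)"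
    using assms(1) by (auto simp: valid_library_def seq_terms_def)
  ultimately show ?case
    using deduction_step(2)[OF lib \<Gamma> km] Suc unfolding valid_rule_def by blast
qed

lemma turnstile_true_iff:
  assumes "is_library M \<rho>" "set \<Gamma> \<subseteq> stmts M" "B \<in> stmts M"
  shows "turnstile M \<Gamma> \<rho> B \<in> true_stmts M \<longleftrightarrow> (\<exists>i. B \<in> set (deduction M \<Gamma> \<rho> i))"
  by (simp add: turnstile_def true_stmts_iff deduce_alg deduce_run assms)

text \<open>Applied to the premises alone, the rule yields \<open>Y\<close>;
  \<open>deduction_closed\<close> from stage 0 turns this single application into a deduction. This
  links containing a rule to satisfying its law.\<close>

lemma implemented_law:
  assumes "is_library M \<rho>" "r \<in> seq_terms M \<rho>" "implements M \<D> r" "(Xs, Y) \<in> \<D> \<rho>"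
    and "set Xs \<subseteq> stmts M" "Y \<in> stmts M"
  shows "turnstile M Xs \<rho> Y \<in> true_stmts M"
proof -
  obtain k where k: "k > 0" "r = seq_term M \<rho> k" using assms(2) by (auto simp: seq_terms_def)
  have "\<rho> \<in> alg_seqs M" using assms(1) by (simp add: is_library_def)
  then obtain Ys where Ys: "outputs M r Xs \<rho> 1 (Xs @ Ys)"
    "set Ys = {Y. \<exists>Zs. (Zs, Y) \<in> \<D> \<rho> \<and> set Zs \<subseteq> set Xs}"
    using assms(3,5) unfolding implements_def by (meson zero_less_one)
  have "\<exists>j. set (Xs @ Ys) \<subseteq> set (deduction M Xs \<rho> j)"
    by (rule deduction_closed[where i = 0 and k = k and m = 1]) (use assms k Ys in auto)
  moreover have "Y \<in> set Ys" using assms(4) Ys(2) by auto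
  ultimately show ?thesis by (auto simp: turnstile_true_iff assms)
qed


section \<open>The Curry sentence\<close>

text \<open>
  The sentence \<open>[c, [c, \<rho>], 1]\<close> says that it refutes itself: \<open>c\<close> receives its own name as part
  of its input, so no recursion theorem is needed.
\<close>

definition curry_sentence :: "'d \<Rightarrow> 'd \<Rightarrow> 'd" where
  "curry_sentence c \<rho> = lst M [c, lst M [c, \<rho>], num M 1]"

lemma exists_curry_algorithm:
  "\<exists>c\<in>algs M. \<forall>\<rho>. run M c (lst M [c, \<rho>]) =
     run M (deduce_alg M) (lst M [lst M [curry_sentence c \<rho>], \<rho>, falsum M])"
proof -
  obtain code where "effective_numbering M code" using effective by blast
  then interpret numbered_model M code by unfold_locales
  \<comment> \<open>On \<open>x = [c, \<rho>]\<close> the triple \<open>[head x, x, num M 1]\<close>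
    is the Curry sentence, so \<open>?h\<close> can be written down before \<open>c\<close>
    exists.\<close>
  let ?h = "\<lambda>x. lst M [lst M [lst M [head x, x, num M 1]], head (rest x), falsum M]"
  have "data_map ?h"
    by (intro data_map_Cons data_map_Nil data_map_const data_map_id data_map_head
        data_map_compose[OF data_map_head data_map_rest])
  from universal_algorithm[OF data_map_const deduce_alg this]
  obtain c where "c \<in> algs M" "\<And>x. run M c x = run M (deduce_alg M) (?h x)" by blast
  then show ?thesis by (intro bexI[of _ c]) (simp_all add: curry_sentence_def)
qed

text \<open>Both sides say that the same run of \<open>deduce\<close> outputs 1, hence the
  equivalence for every datum \<open>\<rho>\<close>, library or not.\<close>

lemma curry_sentence_true_iff:
  assumes "c \<in> algs M" "\<And>\<rho>. run M c (lst M [c, \<rho>]) =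
     run M (deduce_alg M) (lst M [lst M [curry_sentence c \<rho>], \<rho>, falsum M])"
  shows "curry_sentence c \<rho> \<in> true_stmts M \<longleftrightarrow> neg M \<rho> (curry_sentence c \<rho>) \<in> true_stmts M"
proof -
  have "curry_sentence c \<rho> \<in> true_stmts M \<longleftrightarrow>
      run M c (lst M [c, \<rho>]) = Some (num M 1)"
    using assms(1) by (simp add: curry_sentence_def true_stmts_iff)
  then show ?thesis
    by (simp add: assms(2) neg_def conditional_def turnstile_def true_stmts_iff deduce_alg)
qed

text \<open>The common core of both laws: \<open>Cs\<close> stands for the premises to which the law
  is applied. \<open>Cs_map\<close> is assumed for all numberings since one is chosen only inside
  the proof.\<close>

lemma no_refutable_consequences:
  assumes stable: "stable_base M \<B>"
    and c: "c \<in> algs M" "\<And>\<rho>. run M c (lst M [c, \<rho>]) =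
       run M (deduce_alg M) (lst M [lst M [curry_sentence c \<rho>], \<rho>, falsum M])"
    and Cs_map: "\<And>code. effective_numbering M code \<Longrightarrow>
       numbered_model.data_map code (\<lambda>\<rho>. lst M (Cs \<rho>))"
    and Cs_stmts: "\<And>\<rho>. set (Cs \<rho>) \<subseteq> stmts M"
    and Cs_true: "\<And>\<rho>. curry_sentence c \<rho> \<in> true_stmts M \<Longrightarrow> set (Cs \<rho>) \<subseteq> true_stmts M"
    and law: "\<And>\<rho>. base_library M \<B> \<rho> \<Longrightarrow> turnstile M (Cs \<rho>) \<rho> (falsum M) \<in> true_stmts M"
  shows False
proof -
  obtain code where code: "effective_numbering M code" using effective by blast
  then interpret numbered_model M code by unfold_locales
  have "data_map (curry_sentence c)"
    unfolding curry_sentence_def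
    by (intro data_map_Cons data_map_Nil data_map_const data_map_id)
  then obtain r where r: "is_rule M r"
    "\<And>H \<rho> m. run M r (lst M [lst M H, \<rho>, num M m]) =
       Some (lst M (if curry_sentence c \<rho> \<in> set H then H @ Cs \<rho> else H))"
    using conditional_rule[OF _ Cs_map[OF code] Cs_stmts] by metis
  have "is_base M \<B>" using stable by (simp add: stable_base_def)
  then obtain \<rho> where \<rho>: "is_library M \<rho>" "seq_terms M \<rho> = insert r \<B>"
    using insert_base_library r(1) by blast
  let ?Q = "curry_sentence c \<rho>"
  have Q: "set [?Q] \<subseteq> stmts M" using c(1) by (simp add: curry_sentence_def stmts_iff)
  \<comment> \<open>The rule adds \<open>Cs\<close> only if the Curry sentence is among the
    hypotheses; when these are true, \<open>Cs_true\<close> applies.\<close>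
  have "valid_rule M \<rho> r"
    using Cs_true[of \<rho>] by (auto simp: valid_rule_def outputs_def r(2))
  \<comment> \<open>All other rules of \<open>\<rho>\<close> belong to \<open>\<B>\<close>, so
    stability will give validity of the whole library.\<close>
  then have "valid_outside M \<B> \<rho>" by (auto simp: valid_outside_def \<rho>(2))
  moreover have base: "base_library M \<B> \<rho>" using \<rho> by (auto simp: base_library_def)
  ultimately have valid: "valid_library M \<rho>" using stable by (simp add: stable_base_def)
  obtain k where k: "k > 0" "r = seq_term M \<rho> k" using \<rho>(2) by (auto simp: seq_terms_def)
  have "outputs M r [?Q] \<rho> 1 ([?Q] @ Cs \<rho>)" by (simp add: outputs_def r(2))
  then have "\<exists>i. set ([?Q] @ Cs \<rho>) \<subseteq> set (deduction M [?Q] \<rho> i)"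
    using k by (intro deduction_closed[where i = 0 and k = k and m = 1] \<rho>(1) Q) simp_all
  then obtain i where i: "set (Cs \<rho>) \<subseteq> set (deduction M [?Q] \<rho> i)" by auto
  obtain n where "falsum M \<in> set (deduction M (Cs \<rho>) \<rho> n)"
    using law[OF base] turnstile_true_iff[OF \<rho>(1) Cs_stmts falsum_stmt] by blast
  then obtain j where j: "falsum M \<in> set (deduction M [?Q] \<rho> j)"
    using deduction_cut[OF \<rho>(1) Q i] by blast
  then have "neg M \<rho> ?Q \<in> true_stmts M"
    using turnstile_true_iff[OF \<rho>(1) Q falsum_stmt] by (auto simp: neg_def conditional_def)
  \<comment> \<open>The paradox closes: the deduction of falsity from \<open>?Q\<close> is what
    \<open>?Q\<close> asserts, so a valid library has derived falsity from a truth.\<close>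
  then have "set [?Q] \<subseteq> true_stmts M" using curry_sentence_true_iff[OF c] by simp
  then show False using deduction_sound[OF valid] j falsum_not_true by blast
qed

end

theorem corollary14p8:
  fixes M :: "'d logic_model"
  assumes "algorithmic_logic M"
  shows "(\<nexists>\<B>. stable_base M \<B> \<and>
            (\<forall>\<rho>. base_library M \<B> \<rho> \<longrightarrow>
              (\<forall>A\<in>stmts M. \<forall>B\<in>stmts M.
                 turnstile M [or_stmt M A B, neg M \<rho> A] \<rho> B \<in> true_stmts M))) \<and>
         (\<nexists>\<B>. stable_base M \<B> \<and>
            (\<forall>\<rho>. base_library M \<B> \<rho> \<longrightarrow>
              (\<forall>A\<in>stmts M. \<forall>B\<in>stmts M.
                 turnstile M [or_stmt M (neg M \<rho> A) B, A] \<rho> B \<in> true_stmts M))) \<and>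
         (\<nexists>\<B>. stable_base M \<B> \<and>
            (\<exists>r\<in>\<B>. implements M (diagram_P6 M) r \<or> implements M (diagram_P7 M) r))"
proof -
  interpret algorithmic_logic M by (rule assms)
  obtain c where c: "c \<in> algs M" "\<And>\<rho>. run M c (lst M [c, \<rho>]) =
      run M (deduce_alg M) (lst M [lst M [curry_sentence c \<rho>], \<rho>, falsum M])"
    using exists_curry_algorithm by blast
  note Q_iff = curry_sentence_true_iff[OF c]
  have Q_stmt: "curry_sentence c \<rho> \<in> stmts M" for \<rho>
    using c(1) by (simp add: curry_sentence_def stmts_iff)
  note stmt_facts = Q_stmt neg_stmt falsum_stmt or_stmt_stmt
  have P6: False
    if stable: "stable_base M \<B>" and L: "\<And>\<rho> A B. base_library M \<B> \<rho> \<Longrightarrow>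
        A \<in> stmts M \<Longrightarrow> B \<in> stmts M \<Longrightarrow>
        turnstile M [or_stmt M A B, neg M \<rho> A] \<rho> B \<in> true_stmts M" for \<B>
  proof (rule no_refutable_consequences[OF stable c])
    let ?Cs = "\<lambda>\<rho>. [or_stmt M (curry_sentence c \<rho>) (falsum M), neg M \<rho> (curry_sentence c \<rho>)]"
    show "numbered_model.data_map code (\<lambda>\<rho>. lst M (?Cs \<rho>))" if "effective_numbering M code" for code
    proof -
      from that interpret numbered_model M code by unfold_locales
      show ?thesis
        unfolding or_stmt_def neg_def conditional_def turnstile_def curry_sentence_def
        by (intro data_map_Cons data_map_Nil data_map_const data_map_id)
    qed
    show "set (?Cs \<rho>) \<subseteq> stmts M" for \<rho>
      using stmt_facts by simp
    \<comment> \<open>The first disjunct is the Curry sentence itself, true by assumption; its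
      negation is then true by \<open>Q_iff\<close>.\<close>
    show "set (?Cs \<rho>) \<subseteq> true_stmts M" if "curry_sentence c \<rho> \<in> true_stmts M" for \<rho>
      using that Q_iff stmt_facts by (auto intro: or_stmt_true)
    show "turnstile M (?Cs \<rho>) \<rho> (falsum M) \<in> true_stmts M" if "base_library M \<B> \<rho>" for \<rho>
      by (rule L) (use that stmt_facts in simp_all)
  qed
  have P7: False
    if stable: "stable_base M \<B>" and L: "\<And>\<rho> A B. base_library M \<B> \<rho> \<Longrightarrow>
        A \<in> stmts M \<Longrightarrow> B \<in> stmts M \<Longrightarrow>
        turnstile M [or_stmt M (neg M \<rho> A) B, A] \<rho> B \<in> true_stmts M" for \<B>
  proof (rule no_refutable_consequences[OF stable c])
    let ?Cs = "\<lambda>\<rho>. [or_stmt M (neg M \<rho> (curry_sentence c \<rho>)) (falsum M), curry_sentence c \<rho>]"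
    show "numbered_model.data_map code (\<lambda>\<rho>. lst M (?Cs \<rho>))" if "effective_numbering M code" for code
    proof -
      from that interpret numbered_model M code by unfold_locales
      show ?thesis
        unfolding or_stmt_def neg_def conditional_def turnstile_def curry_sentence_def
        by (intro data_map_Cons data_map_Nil data_map_const data_map_id)
    qed
    show "set (?Cs \<rho>) \<subseteq> stmts M" for \<rho>
      using stmt_facts by simp
    \<comment> \<open>Here \<open>Q_iff\<close> makes the negated disjunct true, and with it the
      disjunction.\<close>
    show "set (?Cs \<rho>) \<subseteq> true_stmts M" if "curry_sentence c \<rho> \<in> true_stmts M" for \<rho>
      using that Q_iff stmt_facts by (auto intro: or_stmt_true)
    show "turnstile M (?Cs \<rho>) \<rho> (falsum M) \<in> true_stmts M" if "base_library M \<B> \<rho>" for \<rho>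
      by (rule L) (use that stmt_facts in simp_all)
  qed
  \<comment> \<open>A rule of \<open>\<B>\<close> occurs in every \<open>\<B>\<close>-library, so
    its diagram becomes a law for all of them.\<close>
  have law: "turnstile M Xs \<rho> Y \<in> true_stmts M"
    if "r \<in> \<B>" "implements M \<D> r" "base_library M \<B> \<rho>" "(Xs, Y) \<in> \<D> \<rho>"
      "set Xs \<subseteq> stmts M" "Y \<in> stmts M" for \<B> r \<D> \<rho> Xs Y
    using that by (intro implemented_law[of \<rho> r \<D>]) (auto simp: base_library_def)
  have rule_P6: False if "stable_base M \<B>" "r \<in> \<B>" "implements M (diagram_P6 M) r" for \<B> r
    by (rule P6[OF that(1)], rule law[OF that(2,3)]) (use stmt_facts in \<open>auto simp: diagram_P6_def\<close>)
  have rule_P7: False if "stable_base M \<B>" "r \<in> \<B>" "implements M (diagram_P7 M) r" for \<B> r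
    by (rule P7[OF that(1)], rule law[OF that(2,3)]) (use stmt_facts in \<open>auto simp: diagram_P7_def\<close>)
  show ?thesis
  proof (intro conjI notI; elim exE conjE bexE)
    fix \<B>
    assume "stable_base M \<B>" and "\<forall>\<rho>. base_library M \<B> \<rho> \<longrightarrow> (\<forall>A\<in>stmts M. \<forall>B\<in>stmts M.
        turnstile M [or_stmt M A B, neg M \<rho> A] \<rho> B \<in> true_stmts M)"
    then show False by (intro P6[of \<B>]) auto
  next
    fix \<B>
    assume "stable_base M \<B>" and "\<forall>\<rho>. base_library M \<B> \<rho> \<longrightarrow> (\<forall>A\<in>stmts M. \<forall>B\<in>stmts M.
        turnstile M [or_stmt M (neg M \<rho> A) B, A] \<rho> B \<in> true_stmts M)"
    then show False by (intro P7[of \<B>]) auto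
  next
    fix \<B> r
    assume "stable_base M \<B>" "r \<in> \<B>"
      and "implements M (diagram_P6 M) r \<or> implements M (diagram_P7 M) r"
    then show False using rule_P6 rule_P7 by auto
  qed
qed

end
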